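(* Let $1\le\underline{k}\le\overline{k}$ be integers. As formal power series in $x$ with coefficients in $\mathbb{Z}[y,z]$, the series $\sum_{n,m,r}s_{\underline{k}\le\overline{k}}(n,m,r)x^ny^mz^r$ equals $$\frac{(1-x)(1-xz)+(1-x)\Big(\big(x^{\underline{k}}z^{\underline{k}}-x^{\overline{k}+1}z^{\overline{k}+1}\big)(y-1)+1\Big)+(1-xz)\Big(\big(x^{\underline{k}}-x^{\overline{k}+1}\big)(y-1)+x\Big)}{(1-x)(1-xz)-\Big(\big(x^{\underline{k}}z^{\underline{k}}-x^{\overline{k}+1}z^{\overline{k}+1}\big)(y-1)+xz\Big)\Big(\big(x^{\underline{k}}-x^{\overline{k}+1}\big)(y-1)+x\Big)}.$$
   Context: An $n$-string is a binary string of length $n$; its Hamming weight is its number of ones. A (nonnull) run is a maximal block, of length at least $1$, of consecutive equal bits. For $n\ge 1$, $s_{\underline{k}\le\overline{k}}(n,m,r)$ is the number of $n$-strings of Hamming weight $r$ in which the total number of runs of ones and runs of zeros whose length lies in $[\underline{k},\overline{k}]$ is exactly $m$. By convention $s_{\underline{k}\le\overline{k}}(0,m,r)=2$ if $m=r=0$ and $0$ otherwise (the sum of two contributions, one per starting bit, each initialised as $1$), and the quantity is $0$ if $n<0$, $m<0$ or $r<0$. The sum is over all integers $n,m,r$. *)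

theory Defs
  imports
    "HOL-Computational_Algebra.Polynomial"
    "HOL-Computational_Algebra.Formal_Power_Series"
    "HOL-Library.Groups_Big_Fun"
begin

text \<open>Binary strings are boolean lists, with \<open>True\<close> for the bit one. A run is represented by its
  starting position \<open>i\<close> and its length \<open>l\<close>.\<close>

definition is_run :: "bool list \<Rightarrow> nat \<Rightarrow> nat \<Rightarrow> bool" where
  "is_run w i l \<longleftrightarrow>
     1 \<le> l \<and> i + l \<le> length w \<and>
     (\<forall>j. i \<le> j \<and> j < i + l \<longrightarrow> w ! j = w ! i) \<and>
     (i = 0 \<or> w ! (i - 1) \<noteq> w ! i) \<and>
     (i + l = length w \<or> w ! (i + l) \<noteq> w ! i)"

definition num_runs :: "nat \<Rightarrow> nat \<Rightarrow> bool list \<Rightarrow> nat" where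
  "num_runs k K w = card {(i, l). is_run w i l \<and> k \<le> l \<and> l \<le> K}"

definition hamming_weight :: "bool list \<Rightarrow> nat" where
  "hamming_weight w = count_list w True"

text \<open>The value \<open>2\<close> at \<open>n = m = r = 0\<close> is a convention (one contribution per starting bit); it is not
  the number of empty strings.\<close>

definition s :: "nat \<Rightarrow> nat \<Rightarrow> int \<Rightarrow> int \<Rightarrow> int \<Rightarrow> nat" where
  "s k K n m r =
     (if n < 0 \<or> m < 0 \<or> r < 0 then 0
      else if n = 0 then (if m = 0 \<and> r = 0 then 2 else 0)
      else card {w. int (length w) = n \<and> int (hamming_weight w) = r \<and> int (num_runs k K w) = m})"

text \<open>The ring \<open>\<int>[y,z]\<close> is \<open>int poly poly\<close>, with inner indeterminate \<open>y\<close> and outer indeterminate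
  \<open>z\<close>.\<close>

definition Y :: "int poly poly" where "Y = [:[:0, 1:]:]"

definition Z :: "int poly poly" where "Z = [:0, 1:]"

text \<open>\<open>Sum_any\<close> is only meaningful for finitely many nonzero terms, which \<open>finite_support_s\<close> below
  establishes. Terms with a negative exponent have coefficient zero.\<close>

definition run_gf :: "nat \<Rightarrow> nat \<Rightarrow> int poly poly fps" where
  "run_gf k K = Abs_fps (\<lambda>n. Sum_any (\<lambda>(m :: int, r :: int).
     of_nat (s k K (int n) m r) * Y ^ nat m * Z ^ nat r))"

lemma num_runs_le: "num_runs k K w \<le> (length w + 1) * (length w + 1)"
proof -
  have "{(i, l). is_run w i l \<and> k \<le> l \<and> l \<le> K} \<subseteq> {..length w} \<times> {..length w}"
    by (auto simp: is_run_def)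
  then have "num_runs k K w \<le> card ({..length w} \<times> {..length w})"
    unfolding num_runs_def by (intro card_mono) auto
  then show ?thesis by (simp add: card_cartesian_product)
qed

lemma finite_support_s: "finite {(m, r). s k K n m r \<noteq> 0}"
proof -
  let ?b = "int ((nat n + 1) * (nat n + 1))"
  have "(m, r) \<in> {0..?b} \<times> {0..n}" if "s k K n m r \<noteq> 0" for m r
  proof (cases "n = 0")
    case True
    with that show ?thesis by (auto simp: s_def split: if_splits)
  next
    case False
    with that have pos: "0 < n" "0 \<le> m" "0 \<le> r"
      and ne: "card {w. int (length w) = n \<and> int (hamming_weight w) = r \<and> int (num_runs k K w) = m} \<noteq> 0"
      by (auto simp: s_def split: if_splits)
    from ne have "{w. int (length w) = n \<and> int (hamming_weight w) = r \<and> int (num_runs k K w) = m} \<noteq> {}"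
      by (intro notI) (simp only: card.empty)
    then obtain w where w: "int (length w) = n" "int (hamming_weight w) = r" "int (num_runs k K w) = m"
      by blast
    have "nat n = length w" using w(1) by auto
    then have "m \<le> ?b" using num_runs_le[of k K w] unfolding w(3)[symmetric] of_nat_le_iff by simp
    moreover have "r \<le> n" using w(1,2) count_le_length[of w True] by (simp add: hamming_weight_def)
    ultimately show ?thesis using pos by simp
  qed
  then have "{(m, r). s k K n m r \<noteq> 0} \<subseteq> {0..?b} \<times> {0..n}" by blast
  then show ?thesis by (rule finite_subset) simp
qed

lemma coeff_YZ:
  "coeff (coeff (of_nat c * Y ^ a * Z ^ b) j) i = (if a = i \<and> b = j then int c else 0)"
proof -
  have Y: "Y ^ a = [:monom 1 a:]"
    by (induction a) (simp_all add: Y_def monom_Suc one_pCons)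
  have Z: "Z ^ b = monom 1 b"
    by (simp add: Z_def monom_altdef)
  have "of_nat c * Y ^ a * Z ^ b = monom (of_nat c * monom 1 a) b"
    by (simp add: Y Z of_nat_poly smult_monom)
  then show ?thesis by (simp add: of_nat_poly)
qed

lemma coeff_run_gf:
  "coeff (coeff (fps_nth (run_gf k K) n) r) m = int (s k K (int n) (int m) (int r))"
proof -
  let ?f = "\<lambda>(m :: int, r :: int). of_nat (s k K (int n) m r) * Y ^ nat m * Z ^ nat r"
  let ?S = "{(m, r). s k K (int n) m r \<noteq> 0}"
  have fin: "finite ?S" by (rule finite_support_s)
  have "Sum_any ?f = sum ?f ?S"
  proof (rule Sum_any.expand_superset[OF fin], rule subsetI)
    fix p assume p: "p \<in> {p. ?f p \<noteq> 0}"
    obtain a b where ab: "p = (a, b)" by (cases p)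
    have "s k K (int n) a b \<noteq> 0"
    proof
      assume "s k K (int n) a b = 0"
      with p ab show False by simp
    qed
    with ab show "p \<in> ?S" by simp
  qed
  then have "coeff (coeff (fps_nth (run_gf k K) n) r) m = (\<Sum>p\<in>?S. coeff (coeff (?f p) r) m)"
    by (simp add: run_gf_def coeff_sum)
  also have "\<dots> = (\<Sum>p\<in>?S. if p = (int m, int r) then int (s k K (int n) (int m) (int r)) else 0)"
  proof (rule sum.cong[OF refl])
    fix p assume p: "p \<in> ?S"
    obtain a b where ab: "p = (a, b)" by (cases p)
    with p have "s k K (int n) a b \<noteq> 0" by simp
    then have "0 \<le> a" "0 \<le> b" by (auto simp: s_def split: if_splits)
    then have "nat a = m \<and> nat b = r \<longleftrightarrow> (a, b) = (int m, int r)" by auto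
    then show "coeff (coeff (?f p) r) m = (if p = (int m, int r) then int (s k K (int n) (int m) (int r)) else 0)"
      unfolding ab prod.case coeff_YZ by auto
  qed
  also have "\<dots> = int (s k K (int n) (int m) (int r))"
    using fin by (simp add: sum.delta)
  finally show ?thesis .
qed

end

theory Submission
  imports Defs
begin

text \<open>
  Give a word the weight \<open>y ^ m * z ^ r\<close>, where \<open>m\<close> counts its runs of admissible length and \<open>r\<close>
  its ones. Both statistics are additive over runs, so a word is determined, together with its
  weight, by its first run and the remainder, which is empty or starts with the opposite bit. Let
  \<open>F\<close> and \<open>G\<close> be the series of the words that are empty or start with one, respectively zero, and
  \<open>A\<close> and \<open>B\<close> the series of the words that are a single run of ones, respectively of zeros. Then
  \<open>F = 1 + A * G\<close> and \<open>G = 1 + B * F\<close> (lemma \<open>words_gf_eq\<close>), whence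
  \<open>(1 - A * B) * (F + G) = 2 + A + B\<close>.

  The empty word contributes to both \<open>F\<close> and \<open>G\<close>, which is exactly the convention that the
  coefficient at \<open>n = 0\<close> is \<open>2\<close>; so \<open>F + G\<close> is the series in question
  (lemma \<open>run_gf_eq_words_gf\<close>). Finally \<open>A\<close> and \<open>B\<close> are geometric series with a perturbed block of
  coefficients, and multiplying by \<open>1 - x * z\<close>, respectively \<open>1 - x\<close>, makes them polynomials
  (lemma \<open>single_run_gf_eq\<close>). Multiplying the equation above by both factors yields the quotient.
\<close>

section \<open>Splitting off the first run\<close>

text \<open>Since the remainder does not continue the initial block, that block is a whole run and all
  other runs are runs of the remainder, shifted.\<close>

lemma is_run_replicate_append:
  assumes "1 \<le> l" and v: "v \<noteq> [] \<Longrightarrow> hd v \<noteq> b"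
  shows "is_run (replicate l b @ v) i m \<longleftrightarrow> i = 0 \<and> m = l \<or> l \<le> i \<and> is_run v (i - l) m"
proof -
  let ?w = "replicate l b @ v"
  have nth: "?w ! j = (if j < l then b else v ! (j - l))" for j
    by (simp add: nth_append)
  have v0: "v ! 0 = (\<not> b)" if "v \<noteq> []"
    using v[OF that] that by (simp add: hd_conv_nth)
  show ?thesis
  proof (cases "i < l")
    case True
    have "i = 0 \<and> m = l" if r: "is_run ?w i m"
    proof
      have "i = 0 \<or> ?w ! (i - 1) \<noteq> ?w ! i" using r unfolding is_run_def by blast
      then show i: "i = 0" using True by (auto simp: nth split: if_splits)
      have m: "1 \<le> m" "m \<le> l + length v"
        and const: "\<And>j. j < m \<Longrightarrow> ?w ! j = ?w ! 0"
        and stop: "m = l + length v \<or> ?w ! m \<noteq> ?w ! 0"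
        using r unfolding is_run_def i add_0 length_append length_replicate by (blast intro: le0)+
      have "\<not> l < m"
      proof
        assume "l < m"
        then have "?w ! l = ?w ! 0" "v \<noteq> []" using const[of l] m by auto
        with v0 assms(1) show False by (simp add: nth)
      qed
      moreover have "\<not> m < l"
        using stop assms(1) by (auto simp: nth)
      ultimately show "m = l" by simp
    qed
    moreover have "is_run ?w 0 l"
      using assms(1) v0 by (cases "v = []") (simp_all add: is_run_def nth)
    ultimately show ?thesis using True by auto
  next
    case False
    then obtain d where d: "i = l + d" using le_Suc_ex not_less by blast
    have inner: "(\<forall>j. l + d \<le> j \<and> j < l + d + m \<longrightarrow> ?w ! j = v ! d) \<longleftrightarrow>
        (\<forall>j. d \<le> j \<and> j < d + m \<longrightarrow> v ! j = v ! d)"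
    proof (rule iffI; rule allI; rule impI)
      fix j assume "\<forall>j. l + d \<le> j \<and> j < l + d + m \<longrightarrow> ?w ! j = v ! d" "d \<le> j \<and> j < d + m"
      then have "?w ! (l + j) = v ! d" by (metis add.assoc add_le_cancel_left add_less_cancel_left)
      then show "v ! j = v ! d" by (simp add: nth)
    next
      fix j assume const: "\<forall>j. d \<le> j \<and> j < d + m \<longrightarrow> v ! j = v ! d"
        and j: "l + d \<le> j \<and> j < l + d + m"
      from j have "d \<le> j - l \<and> j - l < d + m" by auto
      with const have "v ! (j - l) = v ! d" by blast
      with j show "?w ! j = v ! d" by (simp add: nth)
    qed
    have left: "?w ! (l + d - 1) \<noteq> v ! d \<longleftrightarrow> d = 0 \<or> v ! (d - 1) \<noteq> v ! d"
      if "1 \<le> m" "d + m \<le> length v"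
    proof -
      have "v ! 0 = (\<not> b)" using that v0 by force
      then show ?thesis using assms(1) by (cases d) (auto simp: nth)
    qed
    have "?w ! (l + d) = v ! d" "?w ! (l + d + m) = v ! (d + m)"
      by (simp_all add: nth)
    then have "is_run ?w i m \<longleftrightarrow>
        1 \<le> m \<and> d + m \<le> length v \<and> (\<forall>j. d \<le> j \<and> j < d + m \<longrightarrow> v ! j = v ! d) \<and>
        ?w ! (l + d - 1) \<noteq> v ! d \<and> (d + m = length v \<or> v ! (d + m) \<noteq> v ! d)"
      unfolding is_run_def d using inner assms(1) by (simp add: add.assoc)
    also have "\<dots> \<longleftrightarrow> is_run v d m"
      unfolding is_run_def using left by blast
    finally have "is_run ?w i m \<longleftrightarrow> is_run v d m" .
    then show ?thesis using d assms(1) by auto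
  qed
qed

lemma num_runs_replicate_append:
  assumes "1 \<le> l" and "v \<noteq> [] \<Longrightarrow> hd v \<noteq> b"
  shows "num_runs k K (replicate l b @ v) = (if k \<le> l \<and> l \<le> K then 1 else 0) + num_runs k K v"
proof -
  let ?R = "\<lambda>w. {(i, m). is_run w i m \<and> k \<le> m \<and> m \<le> K}"
  let ?first = "if k \<le> l \<and> l \<le> K then {(0 :: nat, l)} else {}"
  have fin: "finite (?R v)"
    by (rule finite_subset[of _ "{..length v} \<times> {..length v}"]) (auto simp: is_run_def)
  have "?R (replicate l b @ v) = ?first \<union> (\<lambda>(i, m). (i + l, m)) ` ?R v"
    by (force simp: is_run_replicate_append[OF assms] image_iff)
  also have "card \<dots> = card ?first + card ((\<lambda>(i, m). (i + l, m)) ` ?R v)"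
    by (rule card_Un_disjoint) (use fin assms(1) in auto)
  also have "card ((\<lambda>(i, m). (i + l, m)) ` ?R v) = card (?R v)"
    by (rule card_image) (auto simp: inj_on_def)
  finally show ?thesis by (simp add: num_runs_def)
qed

lemma hamming_weight_replicate_append:
  "hamming_weight (replicate l b @ v) = (if b then l else 0) + hamming_weight v"
  by (induction l) (auto simp: hamming_weight_def)

section \<open>The equations for words by first bit\<close>

text \<open>The empty word belongs to both classes: it is a legitimate remainder after a run of either
  bit.\<close>

definition words :: "bool \<Rightarrow> nat \<Rightarrow> bool list set" where
  "words b n = {w. length w = n \<and> (w \<noteq> [] \<longrightarrow> hd w = b)}"

lemma finite_words: "finite (words b n)"
  by (rule finite_subset[OF _ finite_lists_length_eq[of UNIV n]]) (auto simp: words_def)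

lemma words_0: "words b 0 = {[]}"
  by (auto simp: words_def)

definition weight :: "nat \<Rightarrow> nat \<Rightarrow> bool list \<Rightarrow> int poly poly" where
  "weight k K w = Y ^ num_runs k K w * Z ^ hamming_weight w"

definition bit_weight :: "bool \<Rightarrow> int poly poly" where
  "bit_weight b = (if b then Z else 1)"

text \<open>The value \<open>0\<close> at length \<open>0\<close> excludes the empty run, so the series of single runs has no constant
  term.\<close>

definition run_weight :: "nat \<Rightarrow> nat \<Rightarrow> nat \<Rightarrow> int poly poly" where
  "run_weight k K l = (if l = 0 then 0 else if k \<le> l \<and> l \<le> K then Y else 1)"

definition words_gf :: "nat \<Rightarrow> nat \<Rightarrow> bool \<Rightarrow> int poly poly fps" where
  "words_gf k K b = Abs_fps (\<lambda>n. \<Sum>w\<in>words b n. weight k K w)"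

definition single_run_gf :: "nat \<Rightarrow> nat \<Rightarrow> int poly poly \<Rightarrow> int poly poly fps" where
  "single_run_gf k K c = Abs_fps (\<lambda>l. run_weight k K l * c ^ l)"

lemma weight_Nil: "weight k K [] = 1"
proof -
  have "{(i, l). is_run [] i l \<and> k \<le> l \<and> l \<le> K} = {}" by (auto simp: is_run_def)
  then have "num_runs k K [] = 0" unfolding num_runs_def by (simp only: card.empty)
  then show ?thesis by (simp add: weight_def hamming_weight_def)
qed

lemma weight_replicate_append:
  assumes "1 \<le> l" and "v \<in> words (\<not> b) n"
  shows "weight k K (replicate l b @ v) = run_weight k K l * bit_weight b ^ l * weight k K v"
proof -
  have "v \<noteq> [] \<Longrightarrow> hd v \<noteq> b" using assms(2) by (auto simp: words_def)
  then show ?thesis using assms(1)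
    by (auto simp: weight_def num_runs_replicate_append hamming_weight_replicate_append
        run_weight_def bit_weight_def power_add)
qed

text \<open>The map from (length of the first run, remainder) to words is a bijection, with inverse given
  by \<open>takeWhile\<close> and \<open>dropWhile\<close>.\<close>

lemma sum_words_first_run:
  assumes "1 \<le> n"
  shows "(\<Sum>w\<in>words b n. f w) = (\<Sum>l = 1..n. \<Sum>v\<in>words (\<not> b) (n - l). f (replicate l b @ v))"
proof -
  have tw: "takeWhile (\<lambda>c. c = b) w = replicate (length (takeWhile (\<lambda>c. c = b) w)) b" for w
    by (metis (mono_tags) replicate_length_same set_takeWhileD)
  have split: "replicate (length (takeWhile (\<lambda>c. c = b) w)) b @ dropWhile (\<lambda>c. c = b) w = w" for w
    by (metis tw takeWhile_dropWhile_id)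
  have "(\<Sum>(l, v)\<in>Sigma {1..n} (\<lambda>l. words (\<not> b) (n - l)). f (replicate l b @ v)) = (\<Sum>w\<in>words b n. f w)"
  proof (rule sum.reindex_bij_witness[where
        i = "\<lambda>w. (length (takeWhile (\<lambda>c. c = b) w), dropWhile (\<lambda>c. c = b) w)" and
        j = "\<lambda>(l, v). replicate l b @ v"])
    fix p assume p: "p \<in> Sigma {1..n} (\<lambda>l. words (\<not> b) (n - l))"
    obtain l v where lv: "p = (l, v)" by (cases p)
    with p have l: "1 \<le> l" "l \<le> n" and v: "length v = n - l" "v \<noteq> [] \<Longrightarrow> hd v \<noteq> b"
      by (auto simp: words_def)
    have "takeWhile (\<lambda>c. c = b) v = []" "dropWhile (\<lambda>c. c = b) v = v"
      using v(2) by (cases v; auto)+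
    then show "(length (takeWhile (\<lambda>c. c = b) (case p of (l, v) \<Rightarrow> replicate l b @ v)),
        dropWhile (\<lambda>c. c = b) (case p of (l, v) \<Rightarrow> replicate l b @ v)) = p"
      using takeWhile_append2[of "replicate l b" "\<lambda>c. c = b" v]
        dropWhile_append2[of "replicate l b" "\<lambda>c. c = b" v]
      by (simp add: lv)
    show "(case p of (l, v) \<Rightarrow> replicate l b @ v) \<in> words b n"
      using l v by (auto simp: lv words_def hd_append)
  next
    fix w assume w: "w \<in> words b n"
    then have hw: "length w = n" "w \<noteq> []" "hd w = b"
      using assms by (auto simp: words_def)
    let ?t = "takeWhile (\<lambda>c. c = b) w" and ?d = "dropWhile (\<lambda>c. c = b) w"
    have len: "length ?t + length ?d = n"
      by (metis hw(1) length_append takeWhile_dropWhile_id)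
    have "1 \<le> length ?t" using hw by (cases w) auto
    moreover have "?d \<noteq> [] \<Longrightarrow> hd ?d \<noteq> b"
      using hd_dropWhile[of "\<lambda>c. c = b" w] by auto
    ultimately show "(length ?t, ?d) \<in> Sigma {1..n} (\<lambda>l. words (\<not> b) (n - l))"
      using len by (auto simp: words_def)
  qed (auto simp: split)
  then show ?thesis
    by (subst sum.Sigma) (auto simp: finite_words)
qed

text \<open>The coefficients of the product are convolutions, and splitting off the first run is precisely
  a convolution over its length.\<close>

lemma words_gf_eq:
  "words_gf k K b = 1 + single_run_gf k K (bit_weight b) * words_gf k K (\<not> b)"
proof (rule fps_ext)
  fix n
  let ?c = "bit_weight b"
  show "fps_nth (words_gf k K b) n = fps_nth (1 + single_run_gf k K ?c * words_gf k K (\<not> b)) n"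
  proof (cases "n = 0")
    case True
    then show ?thesis
      by (simp add: words_gf_def single_run_gf_def run_weight_def words_0 weight_Nil)
  next
    case False
    then have "fps_nth (words_gf k K b) n
        = (\<Sum>l = 1..n. \<Sum>v\<in>words (\<not> b) (n - l). run_weight k K l * ?c ^ l * weight k K v)"
      by (auto simp: words_gf_def sum_words_first_run intro!: sum.cong weight_replicate_append)
    also have "\<dots> = (\<Sum>l = 1..n. fps_nth (single_run_gf k K ?c) l * fps_nth (words_gf k K (\<not> b)) (n - l))"
      by (simp add: single_run_gf_def words_gf_def sum_distrib_left)
    also have "\<dots> = (\<Sum>l = 0..n. fps_nth (single_run_gf k K ?c) l * fps_nth (words_gf k K (\<not> b)) (n - l))"
      by (rule sum.mono_neutral_left) (auto simp: single_run_gf_def run_weight_def)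
    finally show ?thesis using False by (simp add: fps_mult_nth)
  qed
qed

section \<open>Closed form of the series\<close>

text \<open>The coefficient of the series is \<open>c ^ l\<close> times \<open>run_weight\<close>, and multiplying by \<open>1 - c * x\<close>
  takes differences of consecutive values of \<open>run_weight\<close>. These vanish except at \<open>1\<close>, where runs
  begin to exist, and at \<open>k\<close> and \<open>K + 1\<close>, where the weight changes from \<open>1\<close> to \<open>Y\<close> and back. The
  cases \<open>c = Z\<close> and \<open>c = 1\<close> are runs of ones and of zeros.\<close>

lemma single_run_gf_eq:
  assumes "1 \<le> k" and "k \<le> K"
  shows "(1 - fps_X * fps_const c) * single_run_gf k K c
    = (fps_X ^ k * fps_const c ^ k - fps_X ^ (K + 1) * fps_const c ^ (K + 1)) * (fps_const Y - 1)
      + fps_X * fps_const c"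
    (is "?L = ?R")
proof (rule fps_ext)
  fix n
  have Y1: "fps_const Y - 1 = fps_const (Y - 1)"
    by (simp flip: fps_const_1_eq_1)
  have mono: "fps_nth (fps_X ^ j * fps_const c ^ j) n = (if n = j then c ^ j else 0)" for j
    by (simp add: fps_const_power)
  have L: "fps_nth ?L n = fps_nth (single_run_gf k K c) n
      - (if n = 0 then 0 else c * fps_nth (single_run_gf k K c) (n - 1))"
    by (simp add: left_diff_distrib mult.assoc)
  have R: "fps_nth ?R n = ((if n = k then c ^ k else 0) - (if n = K + 1 then c ^ (K + 1) else 0)) * (Y - 1)
      + (if n = 1 then c else 0)"
    unfolding Y1 fps_add_nth fps_mult_right_const_nth fps_sub_nth mono by simp
  show "fps_nth ?L n = fps_nth ?R n"
    unfolding L R using assms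
    by (cases n) (auto simp: single_run_gf_def run_weight_def algebra_simps le_Suc_eq)
qed

lemma coeff_sum_weight:
  assumes "finite A"
  shows "coeff (coeff (\<Sum>w\<in>A. weight k K w) r) m
    = int (card {w \<in> A. hamming_weight w = r \<and> num_runs k K w = m})"
proof -
  have "coeff (coeff (weight k K w) r) m
      = (if hamming_weight w = r \<and> num_runs k K w = m then 1 else 0)" for w
    using coeff_YZ[of 1 "num_runs k K w" "hamming_weight w" r m] by (auto simp: weight_def)
  then show ?thesis using assms
    by (simp add: coeff_sum sum.If_cases Int_def)
qed

text \<open>A nonempty word has exactly one first bit; the empty word is counted in both summands,
  giving the conventional value \<open>2\<close>.\<close>

lemma run_gf_eq_words_gf: "run_gf k K = words_gf k K True + words_gf k K False"
proof (intro fps_ext poly_eqI)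
  fix n r m
  let ?P = "\<lambda>w. hamming_weight w = r \<and> num_runs k K w = m"
  show "coeff (coeff (fps_nth (run_gf k K) n) r) m
    = coeff (coeff (fps_nth (words_gf k K True + words_gf k K False) n) r) m"
  proof (cases "n = 0")
    case True
    have "fps_nth (words_gf k K True + words_gf k K False) 0 = of_nat 2 * Y ^ 0 * Z ^ 0"
      by (simp add: words_gf_def words_0 weight_Nil)
    then show ?thesis
      unfolding True by (simp only: coeff_YZ coeff_run_gf) (auto simp: s_def)
  next
    case False
    have "coeff (coeff (fps_nth (run_gf k K) n) r) m = int (card {w. length w = n \<and> ?P w})"
      using False by (simp add: coeff_run_gf s_def)
    also have "{w. length w = n \<and> ?P w} = {w \<in> words True n. ?P w} \<union> {w \<in> words False n. ?P w}"
      by (auto simp: words_def)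
    also have "card \<dots> = card {w \<in> words True n. ?P w} + card {w \<in> words False n. ?P w}"
      using False by (intro card_Un_disjoint) (auto simp: finite_words, auto simp: words_def)
    finally show ?thesis
      by (simp add: words_gf_def coeff_sum_weight[OF finite_words])
  qed
qed

theorem mainTheorem16:
  fixes k K :: nat
  assumes "1 \<le> k" and "k \<le> K"
  defines "x \<equiv> (fps_X :: int poly poly fps)"
    and "y \<equiv> fps_const Y"
    and "z \<equiv> fps_const Z"
  defines "N \<equiv> (1 - x) * (1 - x * z)
      + (1 - x) * ((x ^ k * z ^ k - x ^ (K + 1) * z ^ (K + 1)) * (y - 1) + 1)
      + (1 - x * z) * ((x ^ k - x ^ (K + 1)) * (y - 1) + x)"
    and "D \<equiv> (1 - x) * (1 - x * z)
      - ((x ^ k * z ^ k - x ^ (K + 1) * z ^ (K + 1)) * (y - 1) + x * z)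
        * ((x ^ k - x ^ (K + 1)) * (y - 1) + x)"
  shows "\<exists>E. D * E = 1 \<and> run_gf k K = N * E"
proof -
  define A B where "A = single_run_gf k K Z" and "B = single_run_gf k K 1"
  define F G where "F = words_gf k K True" and "G = words_gf k K False"
  define P Q where "P = (x ^ k * z ^ k - x ^ (K + 1) * z ^ (K + 1)) * (y - 1) + x * z"
    and "Q = (x ^ k - x ^ (K + 1)) * (y - 1) + x"
  have F: "F = 1 + A * G" and G: "G = 1 + B * F"
    using words_gf_eq[of k K True] words_gf_eq[of k K False]
    by (simp_all add: A_def B_def F_def G_def bit_weight_def)
  have A: "(1 - x * z) * A = P"
    using single_run_gf_eq[OF assms(1,2), of Z] by (simp add: A_def P_def x_def y_def z_def)
  have B: "(1 - x) * B = Q"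
    using single_run_gf_eq[OF assms(1,2), of 1] by (simp add: B_def Q_def x_def y_def)
  have N: "N = (1 - x) * (1 - x * z) * (2 + A + B)"
  proof -
    have "N = (1 - x) * (1 - x * z) + (1 - x) * (P - x * z + 1) + (1 - x * z) * Q"
      by (simp add: N_def P_def Q_def)
    then show ?thesis using A B by algebra
  qed
  have D: "D = (1 - x) * (1 - x * z) * (1 - A * B)"
    unfolding D_def P_def[symmetric] Q_def[symmetric] A[symmetric] B[symmetric] by algebra
  have "(1 - A * B) * (F + G) = 2 + A + B"
    using F G by algebra
  then have DN: "D * run_gf k K = N"
    by (simp add: D N run_gf_eq_words_gf F_def G_def mult.assoc)
  \<comment> \<open>The coefficient ring is no field, but a series with constant term \<open>1\<close> is still a unit.\<close>
  have D0: "fps_nth D 0 = 1"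
    using assms(1) by (simp add: D_def x_def y_def z_def)
  define E where "E = fps_right_inverse D 1"
  have DE: "D * E = 1"
    unfolding E_def by (rule fps_right_inverse) (simp add: D0)
  have "run_gf k K = N * E"
    using DE DN by algebra
  with DE show ?thesis by blast
qed

end
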